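(* Let $\theta\in[0,1)$ be irrational, let $x\in\mathbb{R}$, let $\Sigma$ be a finite alphabet, and let $c\colon[0,1)\to\Sigma$ be a non-constant piecewise-constant function with partition boundaries $0=\gamma_0<\gamma_1<\cdots<\gamma_d=1$. Let $\mathbf{a}=a_0a_1a_2\cdots$ be the infinite word defined by $a_i=c(\{i\theta+x\})$ for $i\ge0$. Then $\mathbf{Rdio}(\mathbf{a})=\infty$.
   Context: $\{\cdot\}$ denotes the fractional part. That $c$ is piecewise constant with partition boundaries $0=\gamma_0<\cdots<\gamma_d=1$ means that $c$ is constant on each interval $[\gamma_{j-1},\gamma_j)$, $1\le j\le d$. For integers $0\le r\le s$, $\mathbf{a}[r,s]$ denotes the finite word $a_ra_{r+1}\cdots a_s$. $(\epsilon,\delta)$-closeness: for two finite words $U=u_1\cdots u_L$ and $V=v_1\cdots v_L$ of the same length $L>0$, a real $\epsilon>0$ and an integer $\delta\ge 0$, $U$ and $V$ are $(\epsilon,\delta)$-close if there exist $\delta$ (possibly empty) subintervals $I_1,\dots,I_\delta$ of $\{1,\dots,L\}$ such that $\{1\le i\le L: u_i\ne v_i\}\subseteq \bigcup_{j=1}^{\delta} I_j$ and $\left|\bigcup_{j=1}^{\delta} I_j\right|\le \epsilon L$. Refined Diophantine exponent: for a real $\rho\ge 1$, $\mathbf{a}$ satisfies Condition $( * )_\rho$ if for every $\epsilon>0$ there exist three sequences of integers $(r_n)_{n\ge0}$, $(s_n)_{n\ge0}$, $(t_n)_{n\ge0}$ and an integer $\delta\ge0$ such that: $-1\le r_n<s_n<t_n$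 for all $n$; $t_n\ge\rho s_n$ for all $n$; $s_n-r_n\to\infty$ as $n\to\infty$; and for all $n$ large enough, $\mathbf{a}[r_n+1,r_n+t_n-s_n]$ and $\mathbf{a}[s_n+1,t_n]$ are $(\epsilon,\delta)$-close. The refined Diophantine exponent $\mathbf{Rdio}(\mathbf{a})\in[1,\infty]$ is the supremum of the $\rho$ for which $\mathbf{a}$ satisfies $( * )_\rho$. *)

theory Defs
  imports "HOL-Analysis.Analysis"
begin

(* Only used with 0 \<le> r; the ends are integers because the exponent allows r_n = -1. *)
definition factor :: "(nat \<Rightarrow> 'a) \<Rightarrow> int \<Rightarrow> int \<Rightarrow> 'a list" where
  "factor a r s = map (\<lambda>i. a (nat i)) [r..s]"

(* Positions are numbered 1, ..., L, so the letter u_i is U ! (i - 1).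
   The interval {p..q} is empty when q < p. *)
definition close :: "real \<Rightarrow> nat \<Rightarrow> 'a list \<Rightarrow> 'a list \<Rightarrow> bool" where
  "close \<epsilon> \<delta> U V \<longleftrightarrow>
     length U = length V \<and> length U > 0 \<and>
     (\<exists>I :: nat \<Rightarrow> nat set.
        (\<forall>j\<in>{1..\<delta>}. I j \<subseteq> {1..length U} \<and> (\<exists>p q. I j = {p..q})) \<and>
        {i \<in> {1..length U}. U ! (i - 1) \<noteq> V ! (i - 1)} \<subseteq> (\<Union>j\<in>{1..\<delta>}. I j) \<and>
        real (card (\<Union>j\<in>{1..\<delta>}. I j)) \<le> \<epsilon> * real (length U))"

definition cond_star :: "real \<Rightarrow> (nat \<Rightarrow> 'a) \<Rightarrow> bool" where
  "cond_star \<rho> a \<longleftrightarrow>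
     (\<forall>\<epsilon>>0. \<exists>(r :: nat \<Rightarrow> int) (s :: nat \<Rightarrow> int) (t :: nat \<Rightarrow> int) (\<delta> :: nat).
        (\<forall>n. -1 \<le> r n \<and> r n < s n \<and> s n < t n) \<and>
        (\<forall>n. real_of_int (t n) \<ge> \<rho> * real_of_int (s n)) \<and>
        filterlim (\<lambda>n. s n - r n) at_top sequentially \<and>
        (\<forall>\<^sub>F n in sequentially.
           close \<epsilon> \<delta> (factor a (r n + 1) (r n + t n - s n)) (factor a (s n + 1) (t n))))"

(* A word over a finite alphabet satisfies the condition for \<rho> = 1 (two equal letters far
   apart), so the set is nonempty there and the supremum lies in [1, \<infinity>]. *)
definition Rdio :: "(nat \<Rightarrow> 'a) \<Rightarrow> ereal" where
  "Rdio a = Sup (ereal ` {\<rho>. \<rho> \<ge> 1 \<and> cond_star \<rho> a})"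

definition piecewise_constant :: "(real \<Rightarrow> 'a) \<Rightarrow> (nat \<Rightarrow> real) \<Rightarrow> nat \<Rightarrow> bool" where
  "piecewise_constant c \<gamma> d \<longleftrightarrow>
     \<gamma> 0 = 0 \<and> \<gamma> d = 1 \<and> strict_mono_on {0..d} \<gamma> \<and>
     (\<forall>j\<in>{1..d}. c constant_on {\<gamma> (j - 1)..<\<gamma> j})"

end

theory Submission
  imports Defs
begin

text \<open>
  Let \<open>q\<close> be a record denominator, so that \<open>k \<theta>\<close> for \<open>0 < k < q\<close> is farther from the integers than
  \<open>q \<theta>\<close>, which is at distance \<open>\<eta>\<close>. If \<open>a\<^sub>i \<noteq> a\<^sub>i\<^sub>+\<^sub>q\<close>, then a translate \<open>\<gamma>\<^sub>j + k\<close> lies between \<open>i \<theta> + x\<close>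
  and a point at distance \<open>\<eta>\<close> from it; by the record property each \<open>j\<close> accounts for at most one such
  \<open>i\<close> among \<open>q\<close> consecutive ones. Hence \<open>a\<^sub>0 \<dots> a\<^sub>M\<^sub>q\<^sub>-\<^sub>1\<close> and its shift by \<open>q\<close> differ in at most \<open>d M\<close>
  places, a bound independent of \<open>q\<close>, and one takes these places as one-point intervals.
\<close>

text \<open>Irrationality keeps every \<open>h k\<close> with \<open>k\<close> at least 1 positive,
  while Dirichlet's theorem makes \<open>h\<close> arbitrarily small. The first index at which
  \<open>h\<close> falls below its minimum over an initial segment is therefore a record, and it
  lies beyond that segment.\<close>

lemma irrational_record_denominator:
  fixes \<theta> :: real
  assumes irr: "\<theta> \<notin> \<rat>"
  shows "\<exists>q>N. \<exists>p::int. \<forall>k\<in>{1..<q}. \<forall>l::int. \<bar>real q * \<theta> - p\<bar> < \<bar>real k * \<theta> - l\<bar>"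
proof -
  define h where "h k = \<bar>real k * \<theta> - round (real k * \<theta>)\<bar>" for k :: nat
  have h_le: "h k \<le> \<bar>real k * \<theta> - of_int l\<bar>" for k l
    unfolding h_def using round_diff_minimal[of "real k * \<theta>" l] by simp
  have h_pos: "h k > 0" if "k \<ge> 1" for k
  proof (rule ccontr)
    assume "\<not> h k > 0"
    then have "real k * \<theta> = of_int (round (real k * \<theta>))"
      by (simp add: h_def)
    then have "\<theta> = of_int (round (real k * \<theta>)) / of_nat k"
      using that by (simp add: field_simps)
    also have "\<dots> \<in> \<rat>" by simp
    finally show False using irr by simp
  qed
  define \<mu> where "\<mu> = Min (h ` {1..Suc N})"
  have "\<mu> > 0"
    unfolding \<mu>_def using h_pos by (subst Min_gr_iff) auto
  have \<mu>_le: "\<mu> \<le> h k" if "k \<in> {1..Suc N}" for k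
    unfolding \<mu>_def using that by (intro Min_le) auto
  obtain K :: nat where K: "K > 0" "1 / real K < \<mu>"
    using reals_Archimedean[OF \<open>\<mu> > 0\<close>] by (metis inverse_eq_divide zero_less_Suc)
  obtain l k where kl: "0 < k" "\<bar>of_int k * \<theta> - of_int l\<bar> < 1 / real K"
    using Dirichlet_approx[OF K(1), of \<theta>] by metis
  have ex: "1 \<le> nat k \<and> h (nat k) < \<mu>"
    using h_le[of "nat k" l] kl K by auto
  \<comment> \<open>By minimality every \<open>k\<close> in \<open>{1..<q}\<close> has
    \<open>h k \<ge> \<mu> > h q\<close>. The witness for \<open>p\<close> is the integer nearest to
    \<open>q * \<theta>\<close>.\<close>
  define q where "q = (LEAST k. 1 \<le> k \<and> h k < \<mu>)"
  have q: "1 \<le> q" "h q < \<mu>"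
    using LeastI[of "\<lambda>k. 1 \<le> k \<and> h k < \<mu>", OF ex] by (auto simp: q_def)
  have less: "h q < \<bar>real k * \<theta> - of_int l\<bar>" if "k \<in> {1..<q}" for k l
    using not_less_Least[of k "\<lambda>k. 1 \<le> k \<and> h k < \<mu>"] that q(2) h_le[of k l]
    by (force simp: q_def)
  have "q > N"
    using \<mu>_le[of q] q by force
  then show ?thesis
    using less unfolding h_def by blast
qed

text \<open>The pieces are closed on the left, so a change of value can occur on arrival at a
  boundary; hence strict on the side of \<open>u\<close>, weak on that of \<open>v\<close>. Indices
  \<open>j < d\<close> suffice because \<open>\<gamma> d = \<gamma> 0 + 1\<close>.\<close>

lemma piecewise_constant_boundary_between:
  fixes u v :: real
  assumes pc: "piecewise_constant c \<gamma> d" and "u < v" and neq: "c (frac u) \<noteq> c (frac v)"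
  shows "\<exists>j<d. \<exists>k::int. u < \<gamma> j + k \<and> \<gamma> j + k \<le> v"
proof -
  have \<gamma>: "\<gamma> 0 = 0" "\<gamma> d = 1" and const: "\<And>j. j \<in> {1..d} \<Longrightarrow> c constant_on {\<gamma> (j - 1)..<\<gamma> j}"
    using pc by (auto simp: piecewise_constant_def)
  have "d > 0" using \<gamma> by (cases d) auto
  show ?thesis
  proof (cases "\<lfloor>u\<rfloor> = \<lfloor>v\<rfloor>")
    \<comment> \<open>The integer \<open>\<lfloor>v\<rfloor>\<close> separates the points and is a
      translate of \<open>\<gamma> 0 = 0\<close>.\<close>
    case False
    with \<open>u < v\<close> have "\<lfloor>u\<rfloor> < \<lfloor>v\<rfloor>" using floor_mono[of u v] by simp
    then have "u < of_int \<lfloor>v\<rfloor>" by linarith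
    with \<gamma> \<open>d > 0\<close> show ?thesis by (intro exI[of _ 0] exI[of _ "\<lfloor>v\<rfloor>"] conjI) auto
  next
    case True
    \<comment> \<open>The piece containing \<open>frac v\<close> ends at \<open>\<gamma> j\<close>.
      Its left end is the boundary sought, since \<open>frac u\<close> in the same piece would give
      equal values.\<close>
    define j where "j = (LEAST j. frac v < \<gamma> j)"
    have ex: "frac v < \<gamma> d" using \<gamma> frac_lt_1 by simp
    have j: "frac v < \<gamma> j" "j \<le> d"
      using LeastI[of "\<lambda>j. frac v < \<gamma> j", OF ex] Least_le[of "\<lambda>j. frac v < \<gamma> j", OF ex]
      by (auto simp: j_def)
    have "j \<noteq> 0" using j(1) \<gamma>(1) frac_ge_0[of v] by (metis not_less)
    then have j': "\<gamma> (j - 1) \<le> frac v"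
      using not_less_Least[of "j - 1" "\<lambda>j. frac v < \<gamma> j"] by (simp add: j_def)
    have uv: "frac u < frac v" using True \<open>u < v\<close> by (simp add: frac_def)
    have "frac u < \<gamma> (j - 1)"
    proof (rule ccontr)
      assume "\<not> frac u < \<gamma> (j - 1)"
      then have "frac u \<in> {\<gamma> (j - 1)..<\<gamma> j}" "frac v \<in> {\<gamma> (j - 1)..<\<gamma> j}"
        using uv j j' by auto
      moreover have "c constant_on {\<gamma> (j - 1)..<\<gamma> j}" using const \<open>j \<noteq> 0\<close> j(2) by auto
      ultimately show False using neq unfolding constant_on_def by metis
    qed
    then show ?thesis
      using True j' j(2) \<open>j \<noteq> 0\<close>
      by (intro exI[of _ "j - 1"] exI[of _ "\<lfloor>v\<rfloor>"] conjI) (auto simp: frac_def)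
  qed
qed

lemma rotation_coding_shift_mismatches:
  fixes \<theta> x :: real and p :: int
  assumes pc: "piecewise_constant c \<gamma> d"
    and a: "\<And>i. a i = c (frac (real i * \<theta> + x))"
    and "q > 0"
    and best: "\<And>k l::int. k \<in> {1..<q} \<Longrightarrow> \<bar>real q * \<theta> - p\<bar> < \<bar>real k * \<theta> - l\<bar>"
  shows "card {i. i < M * q \<and> a i \<noteq> a (i + q)} \<le> d * M"
proof -
  let ?D = "{i. i < M * q \<and> a i \<noteq> a (i + q)}"
  define e where "e = real q * \<theta> - p"
  define z where "z i = real i * \<theta> + x" for i :: nat
  \<comment> \<open>The two alternatives cover the two signs of \<open>e\<close>; in both,
    \<open>\<gamma> j + k - z i\<close> lies in a half-open interval of length
    \<open>\<bar>e\<bar>\<close> that does not depend on \<open>i\<close>.\<close>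
  define B where "B i j k \<longleftrightarrow>
    z i < \<gamma> j + of_int k \<and> \<gamma> j + of_int k \<le> z i + e \<or> z i + e < \<gamma> j + of_int k \<and> \<gamma> j + of_int k \<le> z i"
    for i j and k :: int
  have shift: "a (i + q) = c (frac (z i + e))" for i
  proof -
    have "real (i + q) * \<theta> + x = z i + e + of_int p" by (simp add: z_def e_def algebra_simps)
    then show ?thesis by (simp add: a frac_def)
  qed
  have "\<exists>j<d. \<exists>k. B i j k" if "i \<in> ?D" for i
  proof -
    have neq: "c (frac (z i)) \<noteq> c (frac (z i + e))"
      using that shift[of i] a[of i] by (simp add: z_def)
    then consider "z i < z i + e" | "z i + e < z i" by (metis linorder_neqE)
    then show ?thesis
      using piecewise_constant_boundary_between[OF pc _ neq]
        piecewise_constant_boundary_between[OF pc _ neq[symmetric]]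
      unfolding B_def by cases blast+
  qed
  then obtain J K where JK: "\<And>i. i \<in> ?D \<Longrightarrow> J i < d \<and> B i (J i) (K i)" by metis
  \<comment> \<open>Both offsets \<open>\<gamma> j + K i - z i\<close> and
    \<open>\<gamma> j + K i' - z i'\<close> lie in that same interval, so \<open>z i' - z i\<close>
    is within less than \<open>\<bar>e\<bar>\<close> of the integer \<open>K i' - K i\<close>. As
    \<open>0 < i' - i < q\<close>, this contradicts the record property.\<close>
  have no_repeat: False if "i \<in> ?D" "i' \<in> ?D" "i < i'" "J i = J i'" "i div q = i' div q" for i i'
  proof -
    have "i' - i < q"
      using that(3,5) \<open>q > 0\<close>
      by (metis add_diff_cancel_left div_mult_mod_eq less_imp_diff_less mod_less_divisor)
    then have "\<bar>e\<bar> < \<bar>real (i' - i) * \<theta> - of_int (K i' - K i)\<bar>"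
      unfolding e_def using that(3) by (intro best) auto
    moreover have "real (i' - i) * \<theta> = z i' - z i"
      using that(3) by (simp add: z_def of_nat_diff algebra_simps)
    ultimately show False
      using JK[OF that(1)] JK[OF that(2)] that(4) unfolding B_def by auto
  qed
  have "inj_on (\<lambda>i. (J i, i div q)) ?D"
    by (rule inj_onI) (metis (no_types, lifting) no_repeat prod.inject linorder_neqE_nat)
  moreover have "(\<lambda>i. (J i, i div q)) ` ?D \<subseteq> {..<d} \<times> {..<M}"
    using JK \<open>q > 0\<close> by (auto simp: less_mult_imp_div_less)
  ultimately have "card ?D \<le> card ({..<d} \<times> {..<M})"
    by (rule card_inj_on_le) simp
  then show ?thesis by (simp add: card_cartesian_product)
qed

lemma close_if_few_mismatches:
  assumes len: "length U = length V" "length U > 0"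
    and card: "card {i. i < length U \<and> U ! i \<noteq> V ! i} \<le> \<delta>"
    and small: "real \<delta> \<le> \<epsilon> * real (length U)"
  shows "close \<epsilon> \<delta> U V"
proof -
  let ?D = "{i. i < length U \<and> U ! i \<noteq> V ! i}"
  obtain f where f: "bij_betw f {1..card ?D} ?D"
    using ex_bij_betw_nat_finite_1[of ?D] by auto
  \<comment> \<open>\<open>f\<close> enumerates mismatches from position 0, whereas
    \<open>close\<close> counts from 1, hence \<open>Suc\<close>. Past the last mismatch the upper
    end 0 makes the interval empty.\<close>
  define I where "I j = {Suc (f j)..if j \<le> card ?D then Suc (f j) else 0}" for j
  have f_mem: "f j < length U" if "j \<in> {1..card ?D}" for j
    using bij_betwE[OF f] that by blast
  have "{i \<in> {1..length U}. U ! (i - 1) \<noteq> V ! (i - 1)} \<subseteq> (\<Union>j\<in>{1..\<delta>}. I j)"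
  proof
    fix i assume i: "i \<in> {i \<in> {1..length U}. U ! (i - 1) \<noteq> V ! (i - 1)}"
    then have "i - 1 \<in> f ` {1..card ?D}"
      using bij_betw_imp_surj_on[OF f] by auto
    then obtain j where "j \<in> {1..card ?D}" "i - 1 = f j" by blast
    with i card show "i \<in> (\<Union>j\<in>{1..\<delta>}. I j)"
      by (intro UN_I[of j]) (auto simp: I_def)
  qed
  moreover have "card (\<Union>j\<in>{1..\<delta>}. I j) \<le> \<delta>"
  proof -
    have "card (\<Union>j\<in>{1..\<delta>}. I j) \<le> (\<Sum>j\<in>{1..\<delta>}. card (I j))" by (rule card_UN_le) simp
    also have "\<dots> \<le> (\<Sum>j\<in>{1..\<delta>}. 1)" by (rule sum_mono) (simp add: I_def)
    finally show ?thesis by simp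
  qed
  moreover have "I j \<subseteq> {1..length U} \<and> (\<exists>p q. I j = {p..q})" if "j \<in> {1..\<delta>}" for j
  proof
    show "I j \<subseteq> {1..length U}" using that f_mem[of j] by (auto simp: I_def)
    show "\<exists>p q. I j = {p..q}" unfolding I_def by (intro exI) (rule refl)
  qed
  ultimately show ?thesis
    unfolding close_def using len small by (intro conjI exI[of _ I]) auto
qed

lemma factor_nat:
  "length (factor a (int m) (int m + int L - 1)) = L"
  "i < L \<Longrightarrow> factor a (int m) (int m + int L - 1) ! i = a (m + i)"
  by (simp_all add: factor_def nat_add_distrib)

lemma rotation_coding_cond_star:
  fixes \<theta> x \<rho> :: real
  assumes irr: "\<theta> \<notin> \<rat>" and pc: "piecewise_constant c \<gamma> d"
    and a: "\<And>i. a i = c (frac (real i * \<theta> + x))"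
  shows "cond_star \<rho> a"
  unfolding cond_star_def
proof (intro allI impI)
  fix \<epsilon> :: real assume "\<epsilon> > 0"
  \<comment> \<open>\<open>Suc\<close> keeps \<open>M\<close> positive even for
    \<open>\<rho> \<le> 0\<close>, so that the windows are nonempty.\<close>
  define M where "M = Suc (nat \<lceil>\<rho>\<rceil>)"
  have "\<rho> \<le> real M" unfolding M_def by linarith
  have "M \<ge> 1" by (simp add: M_def)
  obtain q where q: "\<And>n. n < q n"
    and "\<forall>n. \<exists>p::int. \<forall>k\<in>{1..<q n}. \<forall>l::int. \<bar>real (q n) * \<theta> - p\<bar> < \<bar>real k * \<theta> - l\<bar>"
    using irrational_record_denominator[OF irr] by metis
  then obtain p :: "nat \<Rightarrow> int" where best:
    "\<And>n k l::int. k \<in> {1..<q n} \<Longrightarrow> \<bar>real (q n) * \<theta> - p n\<bar> < \<bar>real k * \<theta> - l\<bar>"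
    by metis
  \<comment> \<open>The windows have length \<open>M * q n\<close> and start at 0 and
    \<open>q n\<close>.\<close>
  define r :: "nat \<Rightarrow> int" where "r n = - 1" for n
  define s where "s n = int (q n) - 1" for n
  define t where "t n = int (q n) + int (M * q n) - 1" for n
  have q_pos: "q n > 0" for n using q[of n] by simp
  have "-1 \<le> r n \<and> r n < s n \<and> s n < t n" for n
    using q_pos[of n] \<open>M \<ge> 1\<close> by (simp add: r_def s_def t_def)
  moreover have "\<rho> * real_of_int (s n) \<le> real_of_int (t n)" for n
  proof -
    have "\<rho> * real_of_int (s n) \<le> real M * real_of_int (s n)"
      using \<open>\<rho> \<le> real M\<close> q_pos[of n] by (intro mult_right_mono) (auto simp: s_def)
    also have "\<dots> \<le> real_of_int (t n)"
      using q_pos[of n] by (simp add: s_def t_def algebra_simps)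
    finally show ?thesis .
  qed
  moreover have "filterlim (\<lambda>n. s n - r n) at_top sequentially"
  proof (rule filterlim_at_top_mono[OF filterlim_int_sequentially])
    show "\<forall>\<^sub>F n in sequentially. int n \<le> s n - r n"
      using q by (auto simp: s_def r_def less_imp_le)
  qed
  moreover have "\<forall>\<^sub>F n in sequentially. close \<epsilon> (d * M)
      (factor a (r n + 1) (r n + t n - s n)) (factor a (s n + 1) (t n))"
    \<comment> \<open>The mismatch bound \<open>d * M\<close> is fixed while the length
      \<open>M * q n\<close> grows: once \<open>n \<ge> d / \<epsilon>\<close>,
      \<open>q n > n\<close> gives \<open>d \<le> \<epsilon> * q n\<close>.\<close>
    using eventually_ge_at_top[of "nat \<lceil>real d / \<epsilon>\<rceil>"]
  proof eventually_elim
    case (elim n)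
    let ?L = "M * q n"
    have U: "factor a (r n + 1) (r n + t n - s n) = factor a (int 0) (int 0 + int ?L - 1)"
      and V: "factor a (s n + 1) (t n) = factor a (int (q n)) (int (q n) + int ?L - 1)"
      by (simp_all add: r_def s_def t_def)
    have "real d / \<epsilon> \<le> real (q n)" using elim q[of n] by linarith
    then have "real d \<le> \<epsilon> * real (q n)" using \<open>\<epsilon> > 0\<close> by (simp add: field_simps)
    then have small: "real (d * M) \<le> \<epsilon> * real ?L"
      using mult_right_mono[of "real d" "\<epsilon> * real (q n)" "real M"] by (simp add: mult_ac)
    have "{i. i < ?L \<and> factor a (int 0) (int 0 + int ?L - 1) ! i
          \<noteq> factor a (int (q n)) (int (q n) + int ?L - 1) ! i}
        = {i. i < ?L \<and> a i \<noteq> a (i + q n)}"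
      using factor_nat(2)[of _ ?L a 0] factor_nat(2)[of _ ?L a "q n"]
      by (auto simp: add.commute simp del: of_nat_mult)
    also have "card \<dots> \<le> d * M"
      by (rule rotation_coding_shift_mismatches[OF pc a q_pos best])
    finally show ?case
      unfolding U V using small q_pos[of n] \<open>M \<ge> 1\<close>
      by (intro close_if_few_mismatches; unfold factor_nat(1)) auto
  qed
  ultimately show "\<exists>(r :: nat \<Rightarrow> int) (s :: nat \<Rightarrow> int) (t :: nat \<Rightarrow> int) (\<delta> :: nat).
        (\<forall>n. -1 \<le> r n \<and> r n < s n \<and> s n < t n) \<and>
        (\<forall>n. real_of_int (t n) \<ge> \<rho> * real_of_int (s n)) \<and>
        filterlim (\<lambda>n. s n - r n) at_top sequentially \<and>
        (\<forall>\<^sub>F n in sequentially.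
           close \<epsilon> \<delta> (factor a (r n + 1) (r n + t n - s n)) (factor a (s n + 1) (t n)))"
    by blast
qed

theorem theorem7p2:
  fixes \<theta> x :: real and \<Sigma> :: "'a set" and c :: "real \<Rightarrow> 'a"
    and \<gamma> :: "nat \<Rightarrow> real" and d :: nat and a :: "nat \<Rightarrow> 'a"
  assumes "\<theta> \<in> {0..<1}" and "\<theta> \<notin> \<rat>"
    and "finite \<Sigma>" and "c ` {0..<1} \<subseteq> \<Sigma>"
    and "piecewise_constant c \<gamma> d"
    and "\<not> c constant_on {0..<1}"
    and "\<And>i. a i = c (frac (real i * \<theta> + x))"
  shows "Rdio a = \<infinity>"
  unfolding Rdio_def
proof (rule ereal_top)
  fix B :: real
  \<comment> \<open>The maximum with 1 puts the exponent in the admissible range and still dominates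
    \<open>B\<close>.\<close>
  have "cond_star (max 1 B) a"
    using assms(2,5,7) by (rule rotation_coding_cond_star)
  then have "ereal (max 1 B) \<le> Sup (ereal ` {\<rho>. \<rho> \<ge> 1 \<and> cond_star \<rho> a})"
    by (intro Sup_upper imageI) simp
  then show "ereal B \<le> Sup (ereal ` {\<rho>. \<rho> \<ge> 1 \<and> cond_star \<rho> a})"
    by (rule order_trans[rotated]) simp
qed

end
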